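(* Let $V$ be an optimal computer. Then for every computer $C$ there exists $d\in\mathbb{N}$ such that, for every $p\in\{0,1\}^*$, the question whether $p\in\mathrm{Dom}\,C$ can be decided effectively (uniformly in $p$) from $p$ together with the list of all strings $q\in\mathrm{Dom}\,V$ with $|q|\le|p|+d$.
   Context: $\{0,1\}^*$ is the set of finite binary strings. A computer is a partial recursive function $C\colon\{0,1\}^*\to\{0,1\}^*$ whose domain $\mathrm{Dom}\,C$ is prefix-free. A computer $U$ is optimal if for every computer $C$ there is $d\in\mathbb{N}$ such that for every $p\in\mathrm{Dom}\,C$ there is $q$ with $U(q)=C(p)$ and $|q|\le|p|+d$. "Can be decided effectively" means there is an algorithm that, given $p$ and this finite list, correctly outputs whether $p\in\mathrm{Dom}\,C$. *)

theory Defs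
  imports Main "HOL-Library.Sublist" "HOL-Library.Nat_Bijection"
begin

text \<open>
  Partial recursive functions in Kleene's sense. \<open>partial_recursive n f\<close> is only meaningful on
  argument lists of length \<open>n\<close>; the values of \<open>f\<close> on other lists are junk and never used.
\<close>

definition compose ::
  "(nat list \<Rightarrow> nat option) \<Rightarrow> (nat list \<Rightarrow> nat option) list \<Rightarrow> nat list \<Rightarrow> nat option" where
  "compose f gs xs = Option.bind (those (map (\<lambda>g. g xs) gs)) f"

primrec prim_iter ::
  "(nat list \<Rightarrow> nat option) \<Rightarrow> (nat list \<Rightarrow> nat option) \<Rightarrow> nat \<Rightarrow> nat list \<Rightarrow> nat option" where
  "prim_iter g h 0 xs = g xs"
| "prim_iter g h (Suc k) xs = Option.bind (prim_iter g h k xs) (\<lambda>v. h (k # v # xs))"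

text \<open>Unbounded search diverges if the searched function is undefined before its first zero.\<close>

definition minimise :: "(nat list \<Rightarrow> nat option) \<Rightarrow> nat list \<Rightarrow> nat option" where
  "minimise f xs =
     (let first_zero = (\<lambda>z. f (z # xs) = Some 0 \<and> (\<forall>y<z. \<exists>v. f (y # xs) = Some v \<and> v \<noteq> 0))
      in if \<exists>z. first_zero z then Some (THE z. first_zero z) else None)"

inductive partial_recursive :: "nat \<Rightarrow> (nat list \<Rightarrow> nat option) \<Rightarrow> bool" where
  zero: "partial_recursive n (\<lambda>xs. Some 0)"
| suc: "partial_recursive 1 (\<lambda>xs. Some (Suc (hd xs)))"
| proj: "i < n \<Longrightarrow> partial_recursive n (\<lambda>xs. Some (xs ! i))"
| comp: "partial_recursive (length gs) f \<Longrightarrow> \<forall>g\<in>set gs. partial_recursive n g \<Longrightarrow>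
         partial_recursive n (compose f gs)"
| prim: "partial_recursive n g \<Longrightarrow> partial_recursive (Suc (Suc n)) h \<Longrightarrow>
         partial_recursive (Suc n) (\<lambda>xs. prim_iter g h (hd xs) (tl xs))"
| mini: "partial_recursive (Suc n) f \<Longrightarrow> partial_recursive n (minimise f)"

text \<open>
  Binary strings are \<^typ>\<open>bool list\<close>. They are numbered bijectively by the bijective base-2
  numeration, with digits 1 and 2 and the head of the list as the least significant digit.
\<close>

primrec string_encode :: "bool list \<Rightarrow> nat" where
  "string_encode [] = 0"
| "string_encode (b # w) = 2 * string_encode w + (if b then 2 else 1)"

lemma bij_string_encode: "bij string_encode"
proof (rule bijI)
  show "inj string_encode"
  proof (rule injI)
    fix v w show "string_encode v = string_encode w \<Longrightarrow> v = w"
    proof (induction v arbitrary: w)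
      case Nil then show ?case by (cases w) (auto split: if_splits)
    next
      case (Cons b v)
      then obtain c w' where w: "w = c # w'" by (cases w) (auto split: if_splits)
      with Cons.prems have "b = c \<and> string_encode v = string_encode w'"
        by (cases b; cases c) (simp; presburger)+
      with Cons.IH w show ?case by blast
    qed
  qed
  have "\<exists>w. n = string_encode w" for n
  proof (induction n rule: less_induct)
    case (less n)
    show ?case
    proof (cases n)
      case 0 then show ?thesis by (intro exI[of _ "[]"]) simp
    next
      case (Suc m)
      then have "m div 2 < n" by simp
      then obtain w where "m div 2 = string_encode w" using less by blast
      with Suc show ?thesis by (intro exI[of _ "odd m # w"]) (simp; presburger)
    qed
  qed
  then show "surj string_encode" by (simp add: surj_def)
qed

definition computable :: "(bool list \<Rightarrow> bool list option) \<Rightarrow> bool" where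
  "computable C \<longleftrightarrow> (\<exists>f. partial_recursive 1 f \<and>
     (\<forall>w. f [string_encode w] = map_option string_encode (C w)))"

text \<open>
  Algorithms with a yes/no answer (which may also diverge), given a string and a finite list of
  strings.
\<close>

definition computable_test :: "(bool list \<Rightarrow> bool list list \<Rightarrow> bool option) \<Rightarrow> bool" where
  "computable_test A \<longleftrightarrow> (\<exists>f. partial_recursive 2 f \<and>
     (\<forall>w ws. f [string_encode w, list_encode (map string_encode ws)] = map_option of_bool (A w ws)))"

definition prefix_free :: "bool list set \<Rightarrow> bool" where
  "prefix_free S \<longleftrightarrow> (\<forall>p\<in>S. \<forall>q\<in>S. \<not> strict_prefix p q)"

definition computer :: "(bool list \<Rightarrow> bool list option) \<Rightarrow> bool" where
  "computer C \<longleftrightarrow> computable C \<and> prefix_free (dom C)"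

definition optimal :: "(bool list \<Rightarrow> bool list option) \<Rightarrow> bool" where
  "optimal U \<longleftrightarrow> computer U \<and>
     (\<forall>C. computer C \<longrightarrow> (\<exists>d. \<forall>p\<in>dom C. \<exists>q. U q = C p \<and> length q \<le> length p + d))"

end

theory Submission
  imports Defs
begin

text \<open>
  Let \<open>D\<close> be the computer that halts exactly where \<open>C\<close> does and outputs the number of steps that
  \<open>C\<close> takes. By optimality some \<open>q\<close> in the list satisfies \<open>V q = D p\<close> whenever \<open>p \<in> dom C\<close>.
  The algorithm therefore computes \<open>V q\<close> for all listed \<open>q\<close>, all of which halt, and checks whether
  one of the results is a number of steps within which \<open>C\<close> halts on \<open>p\<close>. Running times are obtained
  without a universal machine, by giving each partial recursive function a total step-bounded
  version.
\<close>

section \<open>Recursive functions up to extensional equality\<close>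

text \<open>
  Closing under equality on argument lists of the right length removes the junk values from all
  later arguments.
\<close>

definition recursive_on :: "nat \<Rightarrow> (nat list \<Rightarrow> nat option) \<Rightarrow> bool" where
  "recursive_on n f \<longleftrightarrow> (\<exists>g. partial_recursive n g \<and> (\<forall>xs. length xs = n \<longrightarrow> g xs = f xs))"

definition total_recursive :: "nat \<Rightarrow> (nat list \<Rightarrow> nat) \<Rightarrow> bool" where
  "total_recursive n F \<longleftrightarrow> recursive_on n (\<lambda>xs. Some (F xs))"

lemma recursive_onI: "partial_recursive n f \<Longrightarrow> recursive_on n f"
  unfolding recursive_on_def by blast

lemma recursive_on_cong:
  assumes "recursive_on n f" "\<And>xs. length xs = n \<Longrightarrow> f xs = g xs"
  shows "recursive_on n g"
  using assms unfolding recursive_on_def by auto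

lemma total_recursive_cong:
  assumes "total_recursive n F" "\<And>xs. length xs = n \<Longrightarrow> F xs = G xs"
  shows "total_recursive n G"
  using assms unfolding total_recursive_def by (auto intro: recursive_on_cong)

lemma length_those: "those xs = Some ys \<Longrightarrow> length ys = length xs"
  by (induction xs arbitrary: ys) (auto split: option.splits)

lemma those_eq_Some_iff: "those xs = Some ys \<longleftrightarrow> xs = map Some ys"
  by (induction xs arbitrary: ys) (auto split: option.splits simp: Cons_eq_map_conv)

lemma those_map_Some: "those (map (\<lambda>g. Some (h g)) gs) = Some (map h gs)"
  by (induction gs) auto

text \<open>Whenever \<open>those\<close> succeeds, the list of intermediate results has length
  \<open>length gs\<close>. The outer function is therefore evaluated only where it agrees with its
  representative.\<close>

lemma recursive_on_compose:
  assumes f: "recursive_on (length gs) f" and gs: "\<forall>g\<in>set gs. recursive_on n g"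
  shows "recursive_on n (compose f gs)"
proof -
  obtain f' where f': "partial_recursive (length gs) f'"
      "\<And>xs. length xs = length gs \<Longrightarrow> f' xs = f xs"
    using f unfolding recursive_on_def by blast
  obtain r where r: "\<And>g. g \<in> set gs \<Longrightarrow> partial_recursive n (r g)"
      "\<And>g xs. g \<in> set gs \<Longrightarrow> length xs = n \<Longrightarrow> r g xs = g xs"
    using gs unfolding recursive_on_def by metis
  have "partial_recursive n (compose f' (map r gs))"
    using f' r by (intro partial_recursive.comp) auto
  moreover have "compose f' (map r gs) xs = compose f gs xs" if "length xs = n" for xs
  proof -
    have eq: "map (\<lambda>g. g xs) (map r gs) = map (\<lambda>g. g xs) gs"
      using r that by simp
    show ?thesis
      unfolding compose_def eq using f'(2)
      by (cases "those (map (\<lambda>g. g xs) gs)") (auto dest: length_those)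
  qed
  ultimately show ?thesis unfolding recursive_on_def by blast
qed

lemma recursive_on_minimise:
  assumes "recursive_on (Suc n) f"
  shows "recursive_on n (minimise f)"
proof -
  obtain f' where f': "partial_recursive (Suc n) f'"
      "\<And>xs. length xs = Suc n \<Longrightarrow> f' xs = f xs"
    using assms unfolding recursive_on_def by blast
  then have "minimise f' xs = minimise f xs" if "length xs = n" for xs
    using that by (simp add: minimise_def)
  with f' show ?thesis
    unfolding recursive_on_def by (blast intro: partial_recursive.mini)
qed

section \<open>Composition, primitive recursion and arithmetic for total functions\<close>

lemma total_recursive_compose:
  assumes "total_recursive (length Gs) F" "\<forall>G\<in>set Gs. total_recursive n G"
  shows "total_recursive n (\<lambda>xs. F (map (\<lambda>G. G xs) Gs))"
proof -
  have "recursive_on n (compose (\<lambda>xs. Some (F xs)) (map (\<lambda>G xs. Some (G xs)) Gs))"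
    using assms by (intro recursive_on_compose) (auto simp: total_recursive_def)
  then show ?thesis
    unfolding total_recursive_def compose_def
    by (simp add: comp_def those_map_Some)
qed

lemma total_recursive_Suc:
  assumes "total_recursive n a"
  shows "total_recursive n (\<lambda>xs. Suc (a xs))"
proof -
  have "total_recursive (length [a]) (\<lambda>xs. Suc (hd xs))"
    unfolding total_recursive_def
    using recursive_onI[OF partial_recursive.suc] by simp
  from total_recursive_compose[OF this] assms show ?thesis by simp
qed

lemma total_recursive_const: "total_recursive n (\<lambda>xs. c)"
proof (induction c)
  case 0
  show ?case
    unfolding total_recursive_def by (intro recursive_onI partial_recursive.zero)
qed (rule total_recursive_Suc)

lemma total_recursive_nth: "i < n \<Longrightarrow> total_recursive n (\<lambda>xs. xs ! i)"
  unfolding total_recursive_def by (intro recursive_onI partial_recursive.proj)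

text \<open>Serves to rearrange arguments: \<open>Gs\<close> supply the leading ones, and
  projections pass on everything after the first \<open>k\<close>. With \<open>Gs = []\<close> it
  adds dummy leading arguments, such as the counter and value of a recursion.\<close>

lemma total_recursive_args:
  assumes F: "total_recursive m F"
    and Gs: "\<forall>G\<in>set Gs. total_recursive (k + n) G" and m: "m = length Gs + n"
  shows "total_recursive (k + n) (\<lambda>xs. F (map (\<lambda>G. G xs) Gs @ drop k xs))"
proof -
  let ?Ps = "map (\<lambda>i xs. xs ! (k + i)) [0..<n]"
  have "total_recursive (k + n) (\<lambda>xs. F (map (\<lambda>G. G xs) (Gs @ ?Ps)))"
    using assms by (intro total_recursive_compose) (auto intro: total_recursive_nth)
  then show ?thesis
  proof (rule total_recursive_cong)
    fix xs :: "nat list" assume "length xs = k + n"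
    then have "map (\<lambda>G. G xs) ?Ps = drop k xs"
      by (auto intro!: nth_equalityI)
    then show "F (map (\<lambda>G. G xs) (Gs @ ?Ps)) = F (map (\<lambda>G. G xs) Gs @ drop k xs)"
      by (simp only: map_append)
  qed
qed

lemma total_recursive_compose2:
  assumes "total_recursive 2 F" "total_recursive n a" "total_recursive n b"
  shows "total_recursive n (\<lambda>xs. F [a xs, b xs])"
  using total_recursive_compose[of "[a, b]" F n] assms by (simp add: numeral_2_eq_2)

text \<open>Lets a function be recognised as recursive from a \<open>rec_nat\<close> equation. In
  the step function positions 0 and 1 hold the counter and the previous value, and the parameters
  follow. The schema recurses on its first argument, for which \<open>k\<close> is substituted at
  the end.\<close>

lemma total_recursive_rec_nat:
  assumes k: "total_recursive n k" and g: "total_recursive n g"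
    and h: "total_recursive (2 + n) (\<lambda>ys. h (ys ! 0) (ys ! 1) (drop 2 ys))"
  shows "total_recursive n (\<lambda>xs. rec_nat (g xs) (\<lambda>i v. h i v xs) (k xs))"
proof -
  obtain g' where g': "partial_recursive n g'" "\<And>xs. length xs = n \<Longrightarrow> g' xs = Some (g xs)"
    using g unfolding total_recursive_def recursive_on_def by blast
  obtain h' where h': "partial_recursive (2 + n) h'"
      "\<And>ys. length ys = 2 + n \<Longrightarrow> h' ys = Some (h (ys ! 0) (ys ! 1) (drop 2 ys))"
    using h unfolding total_recursive_def recursive_on_def by blast
  have eq: "prim_iter g' h' i xs = Some (rec_nat (g xs) (\<lambda>i v. h i v xs) i)"
    if "length xs = n" for i xs
    using that g'(2) h'(2) by (induction i) auto
  have "partial_recursive (Suc n) (\<lambda>xs. prim_iter g' h' (hd xs) (tl xs))"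
    using g' h' by (intro partial_recursive.prim) auto
  then have "total_recursive (Suc n) (\<lambda>xs. rec_nat (g (tl xs)) (\<lambda>i v. h i v (tl xs)) (hd xs))"
    unfolding total_recursive_def
    by (rule recursive_on_cong[OF recursive_onI]) (simp add: eq)
  from total_recursive_args[OF this, of "[k]" 0 n] k show ?thesis by simp
qed

text \<open>A case distinction is a recursion on \<open>c\<close> that starts at \<open>a\<close>
  and whose every step returns \<open>b\<close>, whatever the previous value.\<close>

lemma total_recursive_if:
  assumes "total_recursive n c" "total_recursive n a" "total_recursive n b"
  shows "total_recursive n (\<lambda>xs. if c xs = 0 then a xs else b xs)"
proof -
  have "total_recursive (2 + n) (\<lambda>ys. b (drop 2 ys))"
    using total_recursive_args[OF assms(3), of "[]" 2 n] by simp
  from total_recursive_rec_nat[where h = "\<lambda>i v. b", OF assms(1,2) this]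
  show ?thesis
    by (rule total_recursive_cong) (auto split: nat.split simp: gr0_conv_Suc)
qed

lemma total_recursive_pred:
  assumes "total_recursive n a"
  shows "total_recursive n (\<lambda>xs. a xs - 1)"
proof -
  have "total_recursive n (\<lambda>xs. rec_nat 0 (\<lambda>i v. i) (a xs))"
    by (intro total_recursive_rec_nat[where h = "\<lambda>i v xs. i"] assms total_recursive_const
        total_recursive_nth) simp
  moreover have "rec_nat 0 (\<lambda>i v. i) k = k - 1" for k :: nat by (cases k) auto
  ultimately show ?thesis by simp
qed

lemma total_recursive_add:
  assumes "total_recursive n a" "total_recursive n b"
  shows "total_recursive n (\<lambda>xs. a xs + b xs)"
proof -
  have "total_recursive n (\<lambda>xs. rec_nat (a xs) (\<lambda>i v. Suc v) (b xs))"
    using assms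
    by (intro total_recursive_rec_nat[where h = "\<lambda>i v xs. Suc v"])
      (auto intro: total_recursive_Suc total_recursive_nth)
  moreover have "rec_nat m (\<lambda>i v. Suc v) k = m + k" for m k :: nat by (induction k) auto
  ultimately show ?thesis by simp
qed

lemma total_recursive_diff:
  assumes "total_recursive n a" "total_recursive n b"
  shows "total_recursive n (\<lambda>xs. a xs - b xs)"
proof -
  have "total_recursive n (\<lambda>xs. rec_nat (a xs) (\<lambda>i v. v - 1) (b xs))"
    using assms
    by (intro total_recursive_rec_nat[where h = "\<lambda>i v xs. v - 1"])
      (auto intro: total_recursive_pred[simplified] total_recursive_nth)
  moreover have "rec_nat m (\<lambda>i v. v - 1) k = m - k" for m k :: nat by (induction k) auto
  ultimately show ?thesis by simp
qed

section \<open>Decoding pairs and lists\<close>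

lemma total_recursive_triangle:
  assumes "total_recursive n a"
  shows "total_recursive n (\<lambda>xs. triangle (a xs))"
proof -
  have "total_recursive n (\<lambda>xs. rec_nat 0 (\<lambda>i v. v + Suc i) (a xs))"
    using assms
    by (intro total_recursive_rec_nat[where h = "\<lambda>i v xs. v + Suc i"] total_recursive_add
        total_recursive_Suc total_recursive_nth total_recursive_const) auto
  moreover have "rec_nat 0 (\<lambda>i v. v + Suc i) k = triangle k" for k by (induction k) auto
  ultimately show ?thesis by simp
qed

text \<open>The index of the diagonal of the Cantor pairing on which a number lies. With truncated
  subtraction, the test asks whether \<open>triangle (Suc v)\<close> is at most
  \<open>Suc i\<close>, that is, whether the next diagonal has begun.\<close>

definition diagonal :: "nat \<Rightarrow> nat" where
  "diagonal = rec_nat 0 (\<lambda>i v. if triangle (Suc v) - Suc i = 0 then Suc v else v)"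

lemma total_recursive_diagonal:
  assumes "total_recursive n a"
  shows "total_recursive n (\<lambda>xs. diagonal (a xs))"
  unfolding diagonal_def
  by (intro total_recursive_rec_nat
      [where h = "\<lambda>i v xs. if triangle (Suc v) - Suc i = 0 then Suc v else v"]
      assms total_recursive_const total_recursive_if total_recursive_diff
      total_recursive_triangle total_recursive_Suc total_recursive_nth) auto

text \<open>One increment per step suffices: \<open>triangle (Suc v)\<close> exceeds
  \<open>i\<close>, so it can be at most \<open>Suc i\<close> only by equality, and the following
  triangle number is larger still.\<close>

lemma triangle_diagonal: "triangle (diagonal m) \<le> m \<and> m < triangle (Suc (diagonal m))"
  by (induction m) (auto simp: diagonal_def)

text \<open>A pair \<open>(a, b)\<close> is encoded as \<open>triangle (a + b) + a\<close>. The
  diagonal thus gives the sum and the offset on it the first component; encoding the claimed pair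
  again yields \<open>m\<close>.\<close>

lemma prod_decode_diagonal:
  "prod_decode m = (m - triangle (diagonal m), diagonal m - (m - triangle (diagonal m)))"
proof -
  have "m - triangle (diagonal m) \<le> diagonal m" "triangle (diagonal m) \<le> m"
    using triangle_diagonal[of m] by auto
  then have "prod_encode (m - triangle (diagonal m), diagonal m - (m - triangle (diagonal m))) = m"
    by (simp add: prod_encode_def)
  then show ?thesis by (metis prod_encode_inverse)
qed

lemma total_recursive_fst_prod_decode:
  "total_recursive n a \<Longrightarrow> total_recursive n (\<lambda>xs. fst (prod_decode (a xs)))"
  unfolding prod_decode_diagonal fst_conv
  by (intro total_recursive_diff total_recursive_triangle total_recursive_diagonal)

lemma total_recursive_snd_prod_decode:
  "total_recursive n a \<Longrightarrow> total_recursive n (\<lambda>xs. snd (prod_decode (a xs)))"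
  unfolding prod_decode_diagonal snd_conv
  by (intro total_recursive_diff total_recursive_triangle total_recursive_diagonal)

section \<open>Processing lists through their codes\<close>

definition drop_code :: "nat \<Rightarrow> nat \<Rightarrow> nat" where
  "drop_code l = rec_nat l (\<lambda>i v. snd (prod_decode (v - 1)))"

lemma total_recursive_drop_code:
  assumes "total_recursive n a" "total_recursive n b"
  shows "total_recursive n (\<lambda>xs. drop_code (a xs) (b xs))"
  unfolding drop_code_def
  by (intro total_recursive_rec_nat[where h = "\<lambda>i v xs. snd (prod_decode (v - 1))"]
      assms total_recursive_snd_prod_decode total_recursive_pred total_recursive_nth) auto

lemma prod_decode_0: "prod_decode 0 = (0, 0)"
  by (simp add: prod_decode_def prod_decode_aux.simps)

text \<open>A nonempty list has as code the successor of the pair of its head and the code of its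
  tail, so each round takes the tail. The empty list stays fixed because \<open>0 - 1 = 0\<close>
  and \<open>prod_decode 0 = (0, 0)\<close>.\<close>

lemma drop_code_list_encode: "drop_code (list_encode ls) i = list_encode (drop i ls)"
proof (induction i)
  case (Suc i)
  then have "drop_code (list_encode ls) (Suc i) = snd (prod_decode (list_encode (drop i ls) - 1))"
    by (simp add: drop_code_def)
  also have "\<dots> = list_encode (tl (drop i ls))"
    by (cases "drop i ls") (simp_all add: prod_decode_0)
  finally show ?case by (simp add: drop_Suc tl_drop)
qed (simp add: drop_code_def)

lemma length_le_list_encode: "length ls \<le> list_encode ls"
proof (induction ls)
  case (Cons l ls)
  then show ?case using le_prod_encode_2[of "list_encode ls" l] by simp
qed simp

text \<open>The length of the list need not be computed: its code is an upper bound for it, and the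
  surplus rounds meet the code 0 of the empty list and change nothing.\<close>

lemma fold_via_list_encode:
  "rec_nat v0 (\<lambda>i v. if drop_code (list_encode ls) i = 0 then v
      else f (fst (prod_decode (drop_code (list_encode ls) i - 1))) v) (list_encode ls)
   = fold f ls v0"
proof -
  let ?h = "\<lambda>i v. if drop_code (list_encode ls) i = 0 then v
      else f (fst (prod_decode (drop_code (list_encode ls) i - 1))) v"
  have "rec_nat v0 ?h i = fold f (take i ls) v0" for i
  proof (induction i)
    case (Suc i)
    show ?case
    proof (cases "i < length ls")
      case True
      then have "drop i ls = ls ! i # drop (Suc i) ls" by (simp add: Cons_nth_drop_Suc)
      with True Suc show ?thesis
        by (simp add: drop_code_list_encode take_Suc_conv_app_nth)
    qed (use Suc in \<open>simp add: drop_code_list_encode\<close>)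
  qed simp
  then show ?thesis by (simp add: length_le_list_encode)
qed

lemma total_recursive_fold:
  assumes l: "total_recursive n l" and v: "total_recursive n v0"
    and f: "total_recursive (2 + n) (\<lambda>ys. f (ys ! 0) (ys ! 1) (drop 2 ys))"
  shows "total_recursive n (\<lambda>xs. fold (\<lambda>e v. f e v xs) (list_decode (l xs)) (v0 xs))"
proof -
  let ?d = "\<lambda>i xs. drop_code (l xs) i"
  let ?h = "\<lambda>i v xs. if ?d i xs = 0 then v else f (fst (prod_decode (?d i xs - 1))) v xs"
  have d: "total_recursive (2 + n) (\<lambda>ys. ?d (ys ! 0) (drop 2 ys))"
    using total_recursive_args[OF l, of "[]" 2 n]
    by (intro total_recursive_drop_code total_recursive_nth) auto
  have "total_recursive (2 + n)
      (\<lambda>ys. f (fst (prod_decode (?d (ys ! 0) (drop 2 ys) - 1))) (ys ! 1) (drop 2 ys))"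
    using total_recursive_args[OF f, of "[\<lambda>ys. fst (prod_decode (?d (ys ! 0) (drop 2 ys) - 1)),
        \<lambda>ys. ys ! 1]" 2 n]
      total_recursive_fst_prod_decode[OF total_recursive_pred[OF d]] total_recursive_nth[of 1 "2 + n"]
    by (simp add: numeral_2_eq_2)
  then have "total_recursive n (\<lambda>xs. rec_nat (v0 xs) (\<lambda>i v. ?h i v xs) (l xs))"
    by (intro total_recursive_rec_nat[where h = ?h] l v total_recursive_if d total_recursive_nth) auto
  moreover have "rec_nat (v0 xs) (\<lambda>i v. ?h i v xs) (l xs)
      = fold (\<lambda>e v. f e v xs) (list_decode (l xs)) (v0 xs)" for xs
    using fold_via_list_encode[of "v0 xs" "list_decode (l xs)" "\<lambda>e v. f e v xs"]
    by (simp only: list_decode_inverse)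
  ultimately show ?thesis by simp
qed

section \<open>Step-bounded evaluation\<close>

text \<open>
  \<open>F (t # xs)\<close> is \<open>0\<close> if the computation of \<open>f xs\<close> has not stopped with fuel \<open>t\<close>, and the
  successor of its value otherwise.
\<close>

definition bounded_eval :: "nat \<Rightarrow> (nat list \<Rightarrow> nat) \<Rightarrow> (nat list \<Rightarrow> nat option) \<Rightarrow> bool" where
  "bounded_eval n F f \<longleftrightarrow> total_recursive (Suc n) F \<and>
     (\<forall>xs t t' v. length xs = n \<longrightarrow> F (t # xs) = Suc v \<longrightarrow> t \<le> t' \<longrightarrow> F (t' # xs) = Suc v) \<and>
     (\<forall>xs v. length xs = n \<longrightarrow> (f xs = Some v \<longleftrightarrow> (\<exists>t. F (t # xs) = Suc v)))"

lemma bounded_evalI: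
  assumes "total_recursive (Suc n) F"
    and "\<And>xs t t' v. length xs = n \<Longrightarrow> F (t # xs) = Suc v \<Longrightarrow> t \<le> t' \<Longrightarrow> F (t' # xs) = Suc v"
    and "\<And>xs t v. length xs = n \<Longrightarrow> F (t # xs) = Suc v \<Longrightarrow> f xs = Some v"
    and "\<And>xs v. length xs = n \<Longrightarrow> f xs = Some v \<Longrightarrow> \<exists>t. F (t # xs) = Suc v"
  shows "bounded_eval n F f"
  unfolding bounded_eval_def using assms by blast

lemma bounded_eval_total_recursive: "bounded_eval n F f \<Longrightarrow> total_recursive (Suc n) F"
  unfolding bounded_eval_def by blast

lemma bounded_eval_mono:
  "bounded_eval n F f \<Longrightarrow> length xs = n \<Longrightarrow> F (t # xs) = Suc v \<Longrightarrow> t \<le> t' \<Longrightarrow> F (t' # xs) = Suc v"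
  unfolding bounded_eval_def by blast

lemma bounded_eval_iff:
  "bounded_eval n F f \<Longrightarrow> length xs = n \<Longrightarrow> f xs = Some v \<longleftrightarrow> (\<exists>t. F (t # xs) = Suc v)"
  unfolding bounded_eval_def by blast

lemma bounded_eval_eventually:
  assumes "bounded_eval n F f" "length xs = n" "f xs = Some v"
  obtains t0 where "\<And>t. t0 \<le> t \<Longrightarrow> F (t # xs) = Suc v"
  using assms by (metis bounded_eval_iff bounded_eval_mono)

text \<open>Supplies one amount of fuel for finitely many computations at once: the components of a
  composition, the values below a first zero, or the listed programs.\<close>

lemma uniform_eventually:
  fixes P :: "nat \<Rightarrow> 'a \<Rightarrow> bool"
  assumes "finite A" "\<forall>a\<in>A. \<exists>t0. \<forall>t\<ge>t0. P t a"
  shows "\<exists>t0. \<forall>t\<ge>t0. \<forall>a\<in>A. P t a"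
  using eventually_ball_finite[of A P sequentially] assms
  by (simp add: eventually_sequentially)

section \<open>Step-bounded total functions and compositions\<close>

lemma bounded_eval_total:
  assumes "total_recursive n F"
  shows "bounded_eval n (\<lambda>xs. Suc (F (tl xs))) (\<lambda>xs. Some (F xs))"
proof (rule bounded_evalI)
  show "total_recursive (Suc n) (\<lambda>xs. Suc (F (tl xs)))"
    using total_recursive_args[OF assms, of "[]" 1 n]
    by (intro total_recursive_Suc) (simp add: drop_Suc)
qed auto

text \<open>The number of components is arbitrary, so the nested case distinctions are built by
  induction on their list.\<close>

lemma total_recursive_if_ex_zero:
  assumes "\<forall>G\<in>set Gs. total_recursive n G" "total_recursive n H"
  shows "total_recursive n (\<lambda>xs. if \<exists>G\<in>set Gs. G xs = 0 then 0 else H xs)"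
  using assms(1)
proof (induction Gs)
  case (Cons G Gs)
  then have "total_recursive n
      (\<lambda>xs. if G xs = 0 then 0 else if \<exists>G\<in>set Gs. G xs = 0 then 0 else H xs)"
    by (intro total_recursive_if total_recursive_const) auto
  then show ?case by (rule total_recursive_cong) auto
qed (use assms(2) in simp)

text \<open>All components and the outer function receive the same fuel. As long as one component is
  unfinished the result is 0; otherwise subtracting 1 recovers the component values.\<close>

lemma bounded_eval_compose:
  assumes F: "bounded_eval (length gs) F f" and G: "\<forall>g\<in>set gs. bounded_eval n (G g) g"
  shows "bounded_eval n
    (\<lambda>ys. if \<exists>g\<in>set gs. G g ys = 0 then 0 else F (ys ! 0 # map (\<lambda>g. G g ys - 1) gs))
    (compose f gs)" (is "bounded_eval n ?K _")
proof (rule bounded_evalI)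
  have G_rec: "\<forall>g\<in>set gs. total_recursive (Suc n) (G g)"
    using G bounded_eval_total_recursive by blast
  let ?as = "(\<lambda>ys. ys ! 0) # map (\<lambda>g ys. G g ys - 1) gs"
  have "total_recursive (Suc n) (\<lambda>ys. F (map (\<lambda>a. a ys) ?as))"
    using G_rec bounded_eval_total_recursive[OF F]
    by (intro total_recursive_compose)
      (auto intro: total_recursive_nth total_recursive_pred[simplified])
  then have "total_recursive (Suc n) (\<lambda>ys. F (ys ! 0 # map (\<lambda>g. G g ys - 1) gs))"
    by (simp add: comp_def)
  from total_recursive_if_ex_zero[OF _ this, of "map G gs"] G_rec
  show "total_recursive (Suc n) ?K" by simp
next
  fix xs :: "nat list" and t v
  assume len: "length xs = n" and K: "?K (t # xs) = Suc v"
  then have nz: "\<forall>g\<in>set gs. G g (t # xs) \<noteq> 0" by (auto split: if_splits)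
  have F_t: "F (t # map (\<lambda>g. G g (t # xs) - 1) gs) = Suc v" using K nz by auto
  {
    fix t' assume "t \<le> t'"
    then have "\<forall>g\<in>set gs. G g (t' # xs) = G g (t # xs)"
      using nz G len by (metis bounded_eval_mono not0_implies_Suc)
    moreover have "F (t' # map (\<lambda>g. G g (t # xs) - 1) gs) = Suc v"
      using bounded_eval_mono[OF F _ F_t \<open>t \<le> t'\<close>] by simp
    ultimately show "?K (t' # xs) = Suc v" using nz by (simp cong: map_cong)
  }
  have "map (\<lambda>g. g xs) gs = map Some (map (\<lambda>g. G g (t # xs) - 1) gs)"
    using nz G len by (auto simp: bounded_eval_iff intro!: exI[of _ t])
  then have "those (map (\<lambda>g. g xs) gs) = Some (map (\<lambda>g. G g (t # xs) - 1) gs)"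
    by (simp only: those_eq_Some_iff)
  moreover have "f (map (\<lambda>g. G g (t # xs) - 1) gs) = Some v"
    using F_t by (subst bounded_eval_iff[OF F]) auto
  ultimately show "compose f gs xs = Some v" by (simp add: compose_def)
next
  fix xs :: "nat list" and v
  assume len: "length xs = n" and "compose f gs xs = Some v"
  then obtain vs where vs: "map (\<lambda>g. g xs) gs = map Some vs" and f_vs: "f vs = Some v"
    by (auto simp: compose_def those_eq_Some_iff bind_eq_Some_conv)
  have len_vs: "length vs = length gs" using vs by (metis length_map)
  obtain t1 where t1: "\<And>t. t1 \<le> t \<Longrightarrow> F (t # vs) = Suc v"
    using bounded_eval_eventually[OF F len_vs f_vs] by blast
  \<comment> \<open>The value is named \<open>the (g xs)\<close> instead of by its position in
    \<open>vs\<close>, so that thresholds are indexed by the finite set of components.\<close>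
  have "\<forall>g\<in>set gs. \<exists>t0. \<forall>t\<ge>t0. G g (t # xs) = Suc (the (g xs))"
  proof
    fix g assume g: "g \<in> set gs"
    then have "g xs \<in> set (map Some vs)" unfolding vs[symmetric] by auto
    then have "g xs = Some (the (g xs))" by auto
    then show "\<exists>t0. \<forall>t\<ge>t0. G g (t # xs) = Suc (the (g xs))"
      using bounded_eval_eventually[of n "G g" g xs] G g len by metis
  qed
  from uniform_eventually[OF _ this] obtain t2
    where t2: "\<And>t g. t2 \<le> t \<Longrightarrow> g \<in> set gs \<Longrightarrow> G g (t # xs) = Suc (the (g xs))" by auto
  let ?t = "max t1 t2"
  have "map (\<lambda>g. G g (?t # xs) - 1) gs = map (\<lambda>g. the (g xs)) gs" using t2 by simp
  also have "\<dots> = map the (map (\<lambda>g. g xs) gs)" by simp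
  also have "\<dots> = vs" unfolding vs by simp
  finally have "?K (?t # xs) = Suc v" using t1 t2 by simp
  then show "\<exists>t. ?K (t # xs) = Suc v" by blast
qed

section \<open>Step-bounded primitive recursion\<close>

definition bounded_iter ::
  "(nat list \<Rightarrow> nat) \<Rightarrow> (nat list \<Rightarrow> nat) \<Rightarrow> nat \<Rightarrow> nat \<Rightarrow> nat list \<Rightarrow> nat" where
  "bounded_iter G H t k xs =
     rec_nat (G (t # xs)) (\<lambda>i s. if s = 0 then 0 else H (t # i # (s - 1) # xs)) k"

text \<open>Every stage runs with the same fuel, and an unfinished stage keeps all later ones at 0.
  A nonzero result at \<open>Suc k\<close> therefore yields one at \<open>k\<close>, to which the
  induction hypothesis applies.\<close>

lemma bounded_iter_mono:
  assumes G: "bounded_eval n G g" and H: "bounded_eval (Suc (Suc n)) H h"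
    and "length xs = n" "t \<le> t'" "bounded_iter G H t k xs = Suc v"
  shows "bounded_iter G H t' k xs = Suc v"
  using assms(5)
proof (induction k arbitrary: v)
  case 0
  then show ?case using assms by (auto simp: bounded_iter_def intro: bounded_eval_mono[OF G])
next
  case (Suc k)
  then obtain u where u: "bounded_iter G H t k xs = Suc u"
    by (cases "bounded_iter G H t k xs") (auto simp: bounded_iter_def)
  then have "H (t # k # u # xs) = Suc v" using Suc.prems by (simp add: bounded_iter_def)
  then have "H (t' # k # u # xs) = Suc v" using assms by (auto intro: bounded_eval_mono[OF H])
  with Suc.IH[OF u] show ?case by (simp add: bounded_iter_def)
qed

lemma bounded_iter_sound:
  assumes G: "bounded_eval n G g" and H: "bounded_eval (Suc (Suc n)) H h"
    and len: "length xs = n" and "bounded_iter G H t k xs = Suc v"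
  shows "prim_iter g h k xs = Some v"
  using assms(4)
proof (induction k arbitrary: v)
  case 0
  then show ?case using bounded_eval_iff[OF G len] by (auto simp: bounded_iter_def)
next
  case (Suc k)
  then obtain u where u: "bounded_iter G H t k xs = Suc u"
    by (cases "bounded_iter G H t k xs") (auto simp: bounded_iter_def)
  then have "H (t # k # u # xs) = Suc v" using Suc.prems by (simp add: bounded_iter_def)
  then have "h (k # u # xs) = Some v" using len bounded_eval_iff[OF H, of "k # u # xs"] by auto
  with Suc.IH[OF u] show ?case by simp
qed

text \<open>The maximum of the fuel for the first \<open>k\<close> stages and the fuel for the last
  stage serves both, by monotonicity.\<close>

lemma bounded_iter_complete:
  assumes G: "bounded_eval n G g" and H: "bounded_eval (Suc (Suc n)) H h"
    and len: "length xs = n" and "prim_iter g h k xs = Some v"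
  shows "\<exists>t. bounded_iter G H t k xs = Suc v"
  using assms(4)
proof (induction k arbitrary: v)
  case 0
  then show ?case using bounded_eval_iff[OF G len] by (auto simp: bounded_iter_def)
next
  case (Suc k)
  then obtain u where u: "prim_iter g h k xs = Some u" and h: "h (k # u # xs) = Some v"
    by (auto simp: bind_eq_Some_conv)
  obtain t1 where t1: "bounded_iter G H t1 k xs = Suc u" using Suc.IH[OF u] by blast
  obtain t2 where t2: "\<And>t. t2 \<le> t \<Longrightarrow> H (t # k # u # xs) = Suc v"
    using bounded_eval_eventually[OF H _ h] len by auto
  have "bounded_iter G H (max t1 t2) k xs = Suc u"
    by (rule bounded_iter_mono[OF G H len _ t1]) simp
  then have "bounded_iter G H (max t1 t2) (Suc k) xs = Suc v"
    using t2[of "max t1 t2"] by (simp add: bounded_iter_def)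
  then show ?case by blast
qed

lemma bounded_eval_prim_iter:
  assumes G: "bounded_eval n G g" and H: "bounded_eval (Suc (Suc n)) H h"
  shows "bounded_eval (Suc n) (\<lambda>ys. bounded_iter G H (ys ! 0) (ys ! 1) (drop 2 ys))
    (\<lambda>xs. prim_iter g h (hd xs) (tl xs))"
proof (rule bounded_evalI)
  let ?H = "\<lambda>i s ys. if s = 0 then 0 else H (ys ! 0 # i # (s - 1) # drop 2 ys)"
  \<comment> \<open>The arguments \<open>zs\<close> are the counter, the state, the fuel, the
    recursion argument and then the \<open>n\<close> parameters. Hence the fuel is
    \<open>zs ! 2\<close> and the parameters are \<open>drop 4 zs\<close>.\<close>
  have pred: "total_recursive (4 + n) (\<lambda>zs. zs ! 1 - 1)"
    by (intro total_recursive_pred total_recursive_nth) simp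
  have "total_recursive (4 + n)
      (\<lambda>zs. H (map (\<lambda>a. a zs) [\<lambda>zs. zs ! 2, \<lambda>zs. zs ! 0, \<lambda>zs. zs ! 1 - 1] @ drop 4 zs))"
    by (rule total_recursive_args[OF bounded_eval_total_recursive[OF H]])
      (use pred in \<open>auto intro: total_recursive_nth\<close>)
  then have "total_recursive (4 + n)
      (\<lambda>zs. H (zs ! 2 # zs ! 0 # (zs ! 1 - 1) # drop 4 zs))"
    by (simp only: list.map append.simps)
  then have "total_recursive (4 + n)
      (\<lambda>zs. if zs ! 1 = 0 then 0 else H (zs ! 2 # zs ! 0 # (zs ! 1 - 1) # drop 4 zs))"
    by (intro total_recursive_if total_recursive_const total_recursive_nth) auto
  moreover have arity: "4 + n = 2 + (2 + n)" by simp
  ultimately have "total_recursive (2 + (2 + n)) (\<lambda>zs. ?H (zs ! 0) (zs ! 1) (drop 2 zs))"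
    unfolding arity by (elim total_recursive_cong) (simp add: numeral_eq_Suc)
  moreover have "total_recursive (2 + n) (\<lambda>ys. G (map (\<lambda>a. a ys) [\<lambda>ys. ys ! 0] @ drop 2 ys))"
    by (rule total_recursive_args[OF bounded_eval_total_recursive[OF G]])
      (auto intro: total_recursive_nth)
  then have "total_recursive (2 + n) (\<lambda>ys. G (ys ! 0 # drop 2 ys))"
    by (simp only: list.map append.simps)
  ultimately have "total_recursive (2 + n)
      (\<lambda>ys. rec_nat (G (ys ! 0 # drop 2 ys)) (\<lambda>i s. ?H i s ys) (ys ! 1))"
    by (intro total_recursive_rec_nat[where h = ?H] total_recursive_nth) auto
  then show "total_recursive (Suc (Suc n)) (\<lambda>ys. bounded_iter G H (ys ! 0) (ys ! 1) (drop 2 ys))"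
    by (simp add: bounded_iter_def)
next
  fix xs :: "nat list" assume "length xs = Suc n"
  then obtain k xs' where xs: "xs = k # xs'" and len: "length xs' = n" by (cases xs) auto
  {
    fix t t' v
    assume "bounded_iter G H ((t # xs) ! 0) ((t # xs) ! 1) (drop 2 (t # xs)) = Suc v" "t \<le> t'"
    then show "bounded_iter G H ((t' # xs) ! 0) ((t' # xs) ! 1) (drop 2 (t' # xs)) = Suc v"
      using bounded_iter_mono[OF G H len] xs by simp
  }
  {
    fix t v
    assume "bounded_iter G H ((t # xs) ! 0) ((t # xs) ! 1) (drop 2 (t # xs)) = Suc v"
    then show "prim_iter g h (hd xs) (tl xs) = Some v"
      using bounded_iter_sound[OF G H len] xs by simp
  }
  {
    fix v
    assume "prim_iter g h (hd xs) (tl xs) = Some v"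
    then show "\<exists>t. bounded_iter G H ((t # xs) ! 0) ((t # xs) ! 1) (drop 2 (t # xs)) = Suc v"
      using bounded_iter_complete[OF G H len] xs by simp
  }
qed

section \<open>Step-bounded minimisation\<close>

text \<open>
  Here \<open>r z\<close> is the step-bounded value at \<open>z\<close>. State \<open>0\<close> means still searching, \<open>1\<close> that an
  unfinished computation blocks the search, and \<open>z + 2\<close> that the first zero is \<open>z\<close>.
\<close>

definition search :: "(nat \<Rightarrow> nat) \<Rightarrow> nat \<Rightarrow> nat" where
  "search r = rec_nat 0
     (\<lambda>i s. if s = 0 then (if r i = 0 then 1 else if r i - 1 = 0 then i + 2 else 0) else s)"

text \<open>A value \<open>r y\<close> of at least 2 stands for a finished nonzero result, and 1 for
  a finished result 0. The two equivalences are proved together, because the first tells when the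
  state may still change.\<close>

lemma search_spec:
  "(search r i = 0 \<longleftrightarrow> (\<forall>y<i. 2 \<le> r y)) \<and>
   (search r i = Suc (Suc z) \<longleftrightarrow> z < i \<and> r z = 1 \<and> (\<forall>y<z. 2 \<le> r y))"
proof (induction i)
  case 0
  show ?case by (simp add: search_def)
next
  case (Suc i)
  have step: "search r (Suc i) = (if search r i = 0 then
      (if r i = 0 then 1 else if r i - 1 = 0 then i + 2 else 0) else search r i)"
    by (simp add: search_def)
  show ?case
  proof (cases "search r i = 0")
    case True
    then have ge2: "\<forall>y<i. 2 \<le> r y" using Suc by simp
    consider "r i = 0" | "r i = 1" | "2 \<le> r i" by linarith
    then show ?thesis
    proof cases
      case 1
      have "search r (Suc i) = 1" using True 1 by (simp add: step)
      moreover have "\<not> (z < Suc i \<and> r z = 1)" using ge2 1 by (auto simp: less_Suc_eq)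
      moreover have "\<not> (\<forall>y<Suc i. 2 \<le> r y)" using 1 by auto
      ultimately show ?thesis by auto
    next
      case 2
      have "search r (Suc i) = Suc (Suc i)" using True 2 by (simp add: step)
      moreover have "z < Suc i \<and> r z = 1 \<longleftrightarrow> z = i" using ge2 2 by (auto simp: less_Suc_eq)
      moreover have "\<not> (\<forall>y<Suc i. 2 \<le> r y)" using 2 by auto
      ultimately show ?thesis using ge2 by auto
    next
      case 3
      have "search r (Suc i) = 0" using True 3 by (simp add: step)
      moreover have "\<not> (z < Suc i \<and> r z = 1)" using ge2 3 by (auto simp: less_Suc_eq)
      moreover have "\<forall>y<Suc i. 2 \<le> r y" using ge2 3 by (auto simp: less_Suc_eq)
      ultimately show ?thesis by auto
    qed
  next
    case False
    then obtain y where y: "y < i" "\<not> 2 \<le> r y" using Suc by auto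
    have "search r (Suc i) = search r i" using False by (simp add: step)
    moreover have "(search r i = 0) = (\<forall>y<Suc i. 2 \<le> r y)" using False y less_SucI by blast
    moreover have "z < Suc i \<and> r z = 1 \<and> (\<forall>y<z. 2 \<le> r y) \<longleftrightarrow>
        z < i \<and> r z = 1 \<and> (\<forall>y<z. 2 \<le> r y)" using y by (metis less_Suc_eq)
    ultimately show ?thesis using Suc by (simp only:)
  qed
qed

text \<open>Two first zeros would contradict each other at the smaller one, so the description
  operator can be eliminated.\<close>

lemma minimise_eq_Some_iff:
  "minimise f xs = Some z \<longleftrightarrow>
     f (z # xs) = Some 0 \<and> (\<forall>y<z. \<exists>v. f (y # xs) = Some v \<and> v \<noteq> 0)"
proof -
  define P where "P z \<longleftrightarrow> f (z # xs) = Some 0 \<and> (\<forall>y<z. \<exists>v. f (y # xs) = Some v \<and> v \<noteq> 0)" for z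
  have unique: "z = z'" if "P z" "P z'" for z z'
    using that unfolding P_def by (metis linorder_neqE_nat option.inject)
  have "minimise f xs = (if \<exists>z. P z then Some (THE z. P z) else None)"
    unfolding minimise_def P_def Let_def by (rule refl)
  moreover have "(THE z. P z) = z" if "P z" for z
    using that unique by (intro the_equality) auto
  ultimately have "minimise f xs = Some z \<longleftrightarrow> P z" by auto
  then show ?thesis by (simp add: P_def)
qed

text \<open>The fuel bounds both each evaluation and the range of the search. Subtracting 1 merges
  the states 0 and 1 into unfinished and turns \<open>z + 2\<close> into
  \<open>Suc z\<close>.\<close>

lemma bounded_eval_minimise:
  assumes F: "bounded_eval (Suc n) F f"
  shows "bounded_eval n (\<lambda>ys. search (\<lambda>z. F (ys ! 0 # z # drop 1 ys)) (ys ! 0) - 1) (minimise f)"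
proof (rule bounded_evalI)
  let ?h = "\<lambda>i s ys. if s = 0 then (if F (ys ! 0 # i # drop 1 ys) = 0 then 1
    else if F (ys ! 0 # i # drop 1 ys) - 1 = 0 then i + 2 else 0) else s"
  \<comment> \<open>Here \<open>zs\<close> lists the counter, the state, the fuel and the
    parameters, so the fuel is \<open>zs ! 2\<close>.\<close>
  have "total_recursive (3 + n)
      (\<lambda>zs. F (map (\<lambda>a. a zs) [\<lambda>zs. zs ! 2, \<lambda>zs. zs ! 0] @ drop 3 zs))"
    by (rule total_recursive_args[OF bounded_eval_total_recursive[OF F]])
      (auto intro: total_recursive_nth)
  then have "total_recursive (3 + n) (\<lambda>zs. F (zs ! 2 # zs ! 0 # drop 3 zs))"
    by (simp only: list.map append.simps)
  moreover have arity: "3 + n = 2 + Suc n" by simp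
  ultimately have "total_recursive (2 + Suc n) (\<lambda>zs. F (drop 2 zs ! 0 # zs ! 0 # drop 1 (drop 2 zs)))"
    unfolding arity by (elim total_recursive_cong) (simp add: numeral_eq_Suc)
  then have "total_recursive (2 + Suc n) (\<lambda>zs. ?h (zs ! 0) (zs ! 1) (drop 2 zs))"
    by (intro total_recursive_if total_recursive_const total_recursive_nth total_recursive_add
        total_recursive_pred) auto
  then show "total_recursive (Suc n)
      (\<lambda>ys. search (\<lambda>z. F (ys ! 0 # z # drop 1 ys)) (ys ! 0) - 1)"
    unfolding search_def
    by (intro total_recursive_rec_nat[where h = ?h] total_recursive_nth total_recursive_const
        total_recursive_pred) auto
next
  fix xs :: "nat list" assume len: "length xs = n"
  have K: "search (\<lambda>z. F ((t # xs) ! 0 # z # drop 1 (t # xs))) ((t # xs) ! 0) - 1 = Suc z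
      \<longleftrightarrow> z < t \<and> F (t # z # xs) = 1 \<and> (\<forall>y<z. 2 \<le> F (t # y # xs))" for t z
    using search_spec[of "\<lambda>z. F (t # z # xs)" t z] by (cases "search (\<lambda>z. F (t # z # xs)) t") auto
  have ge2: "2 \<le> m \<longleftrightarrow> (\<exists>v. m = Suc v \<and> v \<noteq> 0)" for m :: nat by (cases m) auto
  {
    fix t t' z
    assume "search (\<lambda>z. F ((t # xs) ! 0 # z # drop 1 (t # xs))) ((t # xs) ! 0) - 1 = Suc z"
      and le: "t \<le> t'"
    then have "z < t" "F (t # z # xs) = 1" "\<forall>y<z. 2 \<le> F (t # y # xs)" unfolding K by auto
    \<comment> \<open>Only finished evaluations are stable under more fuel, but a successful search
      consults no others.\<close>
    moreover have "F (t' # y # xs) = F (t # y # xs)" if "F (t # y # xs) \<noteq> 0" for y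
      using bounded_eval_mono[OF F _ _ le, of "y # xs"] len that by (metis length_Cons not0_implies_Suc)
    ultimately have "z < t' \<and> F (t' # z # xs) = 1 \<and> (\<forall>y<z. 2 \<le> F (t' # y # xs))"
      using le by fastforce
    then show "search (\<lambda>z. F ((t' # xs) ! 0 # z # drop 1 (t' # xs))) ((t' # xs) ! 0) - 1 = Suc z"
      unfolding K .
  }
  {
    fix t z
    assume "search (\<lambda>z. F ((t # xs) ! 0 # z # drop 1 (t # xs))) ((t # xs) ! 0) - 1 = Suc z"
    then have "F (t # z # xs) = 1" "\<forall>y<z. 2 \<le> F (t # y # xs)" unfolding K by auto
    then show "minimise f xs = Some z"
      unfolding minimise_eq_Some_iff ge2 using bounded_eval_iff[OF F] len
      by (metis One_nat_def length_Cons)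
  }
  {
    fix z
    assume "minimise f xs = Some z"
    then have z: "f (z # xs) = Some 0" and y: "\<forall>y<z. \<exists>v. f (y # xs) = Some v \<and> v \<noteq> 0"
      unfolding minimise_eq_Some_iff by auto
    obtain t1 where t1: "\<And>t. t1 \<le> t \<Longrightarrow> F (t # z # xs) = 1"
      using bounded_eval_eventually[OF F _ z] len by auto
    have "\<forall>y\<in>{..<z}. \<exists>t0. \<forall>t\<ge>t0. 2 \<le> F (t # y # xs)"
    proof
      fix y assume "y \<in> {..<z}"
      then obtain v where "f (y # xs) = Some v" "v \<noteq> 0" using y by auto
      then show "\<exists>t0. \<forall>t\<ge>t0. 2 \<le> F (t # y # xs)"
        unfolding ge2 using bounded_eval_eventually[OF F, of "y # xs" v] len by (metis length_Cons)
    qed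
    from uniform_eventually[OF _ this] obtain t2
      where t2: "\<And>t y. t2 \<le> t \<Longrightarrow> y < z \<Longrightarrow> 2 \<le> F (t # y # xs)" by auto
    \<comment> \<open>The entry \<open>Suc z\<close> makes the search range, which is bounded by the
      fuel, include \<open>z\<close>.\<close>
    show "\<exists>t. search (\<lambda>z. F ((t # xs) ! 0 # z # drop 1 (t # xs))) ((t # xs) ! 0) - 1 = Suc z"
      unfolding K using t1 t2 by (intro exI[of _ "Max {t1, t2, Suc z}"]) auto
  }
qed

text \<open>Induction on the construction of \<open>f\<close>. For a composition, choice fixes one
  step-bounded version for each component.\<close>

theorem ex_bounded_eval:
  assumes "partial_recursive n f"
  shows "\<exists>F. bounded_eval n F f"
  using assms
proof induction
  case (zero n)
  show ?case using bounded_eval_total[OF total_recursive_const] by blast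
next
  case suc
  have "total_recursive 1 (\<lambda>xs. Suc (hd xs))"
    unfolding total_recursive_def by (intro recursive_onI partial_recursive.suc)
  from bounded_eval_total[OF this] show ?case by blast
next
  case (proj i n)
  then show ?case using bounded_eval_total[OF total_recursive_nth] by blast
next
  case (comp gs f n)
  from comp.IH(1) obtain F where F: "bounded_eval (length gs) F f" ..
  have "\<forall>g\<in>set gs. \<exists>F. bounded_eval n F g" using comp.IH(2) by blast
  from bchoice[OF this] obtain G where G: "\<forall>g\<in>set gs. bounded_eval n (G g) g" ..
  show ?case by (intro exI) (rule bounded_eval_compose[OF F G])
next
  case (prim n g h)
  from prim.IH obtain G H where "bounded_eval n G g" "bounded_eval (Suc (Suc n)) H h" by blast
  then show ?case by (intro exI) (rule bounded_eval_prim_iter)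
next
  case (mini n f)
  from mini.IH obtain F where "bounded_eval (Suc n) F f" ..
  then show ?case by (intro exI) (rule bounded_eval_minimise)
qed


section \<open>Deciding halting from the list of programs of an optimal computer\<close>

text \<open>No value of a total function can block the search, so only the least zero
  matters.\<close>

lemma minimise_total:
  "minimise (\<lambda>xs. Some (F xs)) xs =
     (if \<exists>z. F (z # xs) = 0 then Some (LEAST z. F (z # xs) = 0) else None)"
proof (cases "\<exists>z. F (z # xs) = 0")
  case True
  let ?z = "LEAST z. F (z # xs) = 0"
  have "F (?z # xs) = 0" using True by (rule LeastI_ex)
  moreover have "F (y # xs) \<noteq> 0" if "y < ?z" for y using that by (rule not_less_Least)
  ultimately have "minimise (\<lambda>xs. Some (F xs)) xs = Some ?z"
    unfolding minimise_eq_Some_iff by blast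
  with True show ?thesis by (simp only: if_True)
next
  case False
  have "minimise (\<lambda>xs. Some (F xs)) xs \<noteq> Some z" for z
    unfolding minimise_eq_Some_iff using False by simp
  then have "minimise (\<lambda>xs. Some (F xs)) xs = None"
    by (cases "minimise (\<lambda>xs. Some (F xs)) xs") (simp, blast)
  with False show ?thesis by (simp only: if_False)
qed

lemma string_encode_inv: "string_encode (inv string_encode n) = n"
  using bij_string_encode by (simp add: bij_is_surj surj_f_inv_f)

lemma computableI:
  assumes "recursive_on 1 f" "\<And>w. f [string_encode w] = map_option string_encode (C w)"
  shows "computable C"
proof -
  obtain g where "partial_recursive 1 g" "\<And>xs. length xs = 1 \<Longrightarrow> g xs = f xs"
    using assms(1) unfolding recursive_on_def by blast
  with assms(2) show ?thesis
    unfolding computable_def by (intro exI[of _ g]) auto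
qed

text \<open>Restates step-bounded evaluation for strings: halting computations finish from some fuel
  on, and whatever finishes gives the correct value.\<close>

lemma ex_bounded_eval_computable:
  assumes "computable C"
  shows "\<exists>F. total_recursive 2 F \<and>
    (\<forall>w v. C w = Some v \<longrightarrow> (\<exists>t0. \<forall>t\<ge>t0. F [t, string_encode w] = Suc (string_encode v))) \<and>
    (\<forall>w t k. F [t, string_encode w] = Suc k \<longrightarrow> map_option string_encode (C w) = Some k)"
proof -
  obtain f where f: "partial_recursive 1 f"
      "\<And>w. f [string_encode w] = map_option string_encode (C w)"
    using assms unfolding computable_def by blast
  obtain F where F: "bounded_eval 1 F f" using ex_bounded_eval[OF f(1)] by blast
  show ?thesis
  proof (intro exI[of _ F] conjI allI impI)
    show "total_recursive 2 F"
      using bounded_eval_total_recursive[OF F] by (simp add: numeral_2_eq_2)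
    show "\<exists>t0. \<forall>t\<ge>t0. F [t, string_encode w] = Suc (string_encode v)" if "C w = Some v" for w v
    proof -
      have "f [string_encode w] = Some (string_encode v)" using f(2) that by simp
      from bounded_eval_eventually[OF F _ this] obtain t0
        where "\<And>t. t0 \<le> t \<Longrightarrow> F [t, string_encode w] = Suc (string_encode v)" by auto
      then show ?thesis by (intro exI[of _ t0] allI impI)
    qed
    show "map_option string_encode (C w) = Some k" if "F [t, string_encode w] = Suc k" for w t k
      unfolding f(2)[symmetric] using bounded_eval_iff[OF F, of "[string_encode w]" k] that by auto
  qed
qed

text \<open>\<open>D\<close> outputs the string whose number is the least fuel with which the
  step-bounded version \<open>H\<close> of \<open>C\<close> finishes. The domain condition on
  \<open>H\<close> holds for every \<open>t\<close>, so testing unrelated numbers as fuel can never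
  produce a false positive.\<close>

lemma halting_time_computer:
  assumes "computer C"
  obtains H D where "total_recursive 2 H" "computer D" "dom D = dom C"
    and "\<And>p t. H [t, string_encode p] \<noteq> 0 \<Longrightarrow> p \<in> dom C"
    and "\<And>p s. D p = Some s \<Longrightarrow> H [string_encode s, string_encode p] \<noteq> 0"
proof -
  have "computable C" using assms by (simp add: computer_def)
  then obtain H where H: "total_recursive 2 H"
    and complete: "\<forall>w v. C w = Some v \<longrightarrow>
      (\<exists>t0. \<forall>t\<ge>t0. H [t, string_encode w] = Suc (string_encode v))"
    and sound: "\<forall>w t k. H [t, string_encode w] = Suc k \<longrightarrow>
      map_option string_encode (C w) = Some k"
    using ex_bounded_eval_computable[of C] by blast
  have dom: "p \<in> dom C \<longleftrightarrow> (\<exists>t. H [t, string_encode p] \<noteq> 0)" for p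
  proof
    assume "p \<in> dom C"
    then obtain v where "C p = Some v" by blast
    with complete obtain t0 where "\<forall>t\<ge>t0. H [t, string_encode p] = Suc (string_encode v)" by blast
    then show "\<exists>t. H [t, string_encode p] \<noteq> 0" by (intro exI[of _ t0]) simp
  next
    assume "\<exists>t. H [t, string_encode p] \<noteq> 0"
    then obtain t k where "H [t, string_encode p] = Suc k" using not0_implies_Suc by blast
    then show "p \<in> dom C" using sound by blast
  qed
  \<comment> \<open>The flag inverts \<open>H\<close>: minimisation looks for a zero, whereas
    \<open>H\<close> is nonzero once the computation has finished.\<close>
  let ?time = "minimise (\<lambda>xs. Some (if H xs = 0 then 1 else 0))"
  define D where "D p = map_option (inv string_encode) (?time [string_encode p])" for p
  have time: "?time [string_encode p] = (if p \<in> dom C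
      then Some (LEAST t. H [t, string_encode p] \<noteq> 0) else None)" for p
    unfolding minimise_total dom by (auto intro: arg_cong[where f = Least])
  have "total_recursive 2 (\<lambda>xs. if H xs = 0 then 1 else 0)"
    by (intro total_recursive_if H total_recursive_const)
  then have "recursive_on 1 ?time"
    by (intro recursive_on_minimise) (simp add: total_recursive_def numeral_2_eq_2)
  then have "computable D"
    by (rule computableI) (simp add: D_def option.map_comp comp_def string_encode_inv option.map_ident)
  moreover have dom_D: "dom D = dom C" by (auto simp: D_def time split: if_splits)
  \<comment> \<open>Prefix-freeness depends on the domain alone, which \<open>D\<close> shares with
    \<open>C\<close>.\<close>
  ultimately have "computer D" using assms by (simp add: computer_def)
  moreover have "H [string_encode s, string_encode p] \<noteq> 0" if "D p = Some s" for p s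
  proof -
    have p: "p \<in> dom C" using that dom_D by blast
    then have "string_encode s = (LEAST t. H [t, string_encode p] \<noteq> 0)"
      using that by (auto simp: D_def time string_encode_inv)
    then show ?thesis using LeastI_ex[of "\<lambda>t. H [t, string_encode p] \<noteq> 0"] p dom by simp
  qed
  ultimately show thesis using that[OF H _ dom_D] dom by blast
qed

section \<open>The decision procedure on a list of programs\<close>

lemma fold_flag:
  "fold (\<lambda>e v. if P e then 1 else v) ls v = (if \<exists>e\<in>set ls. P e then 1 else v)"
  by (induction ls arbitrary: v) auto

lemma fold_flag_unless:
  "fold (\<lambda>e v. if P e then v else 1) ls v = (if \<forall>e\<in>set ls. P e then v else 1)"
  by (induction ls arbitrary: v) auto

text \<open>The algorithm first searches for fuel with which all listed programs finish, and then
  tries each output as fuel for \<open>H\<close>. The search diverges exactly if some listed string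
  is outside \<open>dom V\<close>, hence the value \<open>None\<close> there.\<close>

lemma computable_test_halting:
  assumes "computable V" and H: "total_recursive 2 H"
  shows "computable_test (\<lambda>w ws. if set ws \<subseteq> dom V
    then Some (\<exists>q\<in>set ws. H [string_encode (the (V q)), string_encode w] \<noteq> 0) else None)"
    (is "computable_test ?A")
proof -
  obtain F where F: "total_recursive 2 F"
    and complete: "\<forall>w v. V w = Some v \<longrightarrow>
      (\<exists>t0. \<forall>t\<ge>t0. F [t, string_encode w] = Suc (string_encode v))"
    and sound: "\<forall>w t k. F [t, string_encode w] = Suc k \<longrightarrow>
      map_option string_encode (V w) = Some k"
    using ex_bounded_eval_computable[OF assms(1)] by blast
  \<comment> \<open>The arguments of \<open>running\<close> and \<open>hit\<close> are the fuel, the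
    number of the string and the code of the list. The flag \<open>running\<close> is 0 once all
    listed programs have finished.\<close>
  define running :: "nat list \<Rightarrow> nat" where "running xs =
    fold (\<lambda>e v. if F [xs ! 0, e] = 0 then 1 else v) (list_decode (xs ! 2)) 0" for xs
  define hit :: "nat list \<Rightarrow> nat" where "hit xs =
    fold (\<lambda>e v. if H [F [xs ! 0, e] - 1, xs ! 1] = 0 then v else 1) (list_decode (xs ! 2)) 0" for xs
  let ?time = "minimise (\<lambda>xs. Some (running xs))"
  let ?f = "compose (\<lambda>xs. Some (hit xs)) [?time, \<lambda>xs. Some (xs ! 0), \<lambda>xs. Some (xs ! 1)]"
  \<comment> \<open>Inside the fold the element and the accumulator come first, which shifts the
    fuel to position 2 and the string to position 3.\<close>
  have "total_recursive (2 + 3) (\<lambda>ys. ys ! 2)"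
    by (intro total_recursive_nth) simp
  then have time: "total_recursive (2 + 3) (\<lambda>ys. drop 2 ys ! 0)"
    by (rule total_recursive_cong) simp
  have "total_recursive (2 + 3) (\<lambda>ys. ys ! 3)"
    by (intro total_recursive_nth) simp
  then have word: "total_recursive (2 + 3) (\<lambda>ys. drop 2 ys ! 1)"
    by (rule total_recursive_cong) (simp add: numeral_eq_Suc)
  have F': "total_recursive (2 + 3) (\<lambda>ys. F [drop 2 ys ! 0, ys ! 0])"
    by (intro total_recursive_compose2[OF F] time total_recursive_nth) simp
  then have H': "total_recursive (2 + 3) (\<lambda>ys. H [F [drop 2 ys ! 0, ys ! 0] - 1, drop 2 ys ! 1])"
    by (intro total_recursive_compose2[OF H] word total_recursive_pred)
  have running_rec: "total_recursive 3 running"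
    unfolding running_def
    by (intro total_recursive_fold[where f = "\<lambda>e v xs. if F [xs ! 0, e] = 0 then 1 else v"]
        total_recursive_if F' total_recursive_nth total_recursive_const) auto
  have hit_rec: "total_recursive 3 hit"
    unfolding hit_def
    by (intro total_recursive_fold
        [where f = "\<lambda>e v xs. if H [F [xs ! 0, e] - 1, xs ! 1] = 0 then v else 1"]
        total_recursive_if H' total_recursive_nth total_recursive_const) auto
  have "recursive_on 2 ?time"
    using running_rec
    by (intro recursive_on_minimise) (simp add: total_recursive_def numeral_eq_Suc)
  moreover have "recursive_on 3 (\<lambda>xs. Some (hit xs))"
    using hit_rec by (simp add: total_recursive_def)
  moreover have "recursive_on 2 (\<lambda>xs. Some (xs ! 0))" "recursive_on 2 (\<lambda>xs. Some (xs ! 1))"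
    by (auto intro!: recursive_onI partial_recursive.proj)
  ultimately have f: "recursive_on 2 ?f"
    by (intro recursive_on_compose) (auto simp: numeral_3_eq_3)
  have "?f [string_encode w, list_encode (map string_encode ws)] = map_option of_bool (?A w ws)"
    for w ws
  proof -
    let ?xs = "[string_encode w, list_encode (map string_encode ws)]"
    have running: "running (s # ?xs) = 0 \<longleftrightarrow> (\<forall>q\<in>set ws. F [s, string_encode q] \<noteq> 0)" for s
      by (simp add: running_def fold_flag)
    have hit: "hit (s # ?xs) = of_bool
        (\<exists>q\<in>set ws. H [F [s, string_encode q] - 1, string_encode w] \<noteq> 0)" for s
      by (simp add: hit_def fold_flag_unless)
    have halts: "q \<in> dom V \<and> F [s, string_encode q] = Suc (string_encode (the (V q)))"
      if nz: "F [s, string_encode q] \<noteq> 0" for s q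
    proof -
      obtain k where k: "F [s, string_encode q] = Suc k" using not0_implies_Suc[OF nz] ..
      from sound[rule_format, OF k] obtain v where "V q = Some v" "string_encode v = k" by auto
      with k show ?thesis by auto
    qed
    show ?thesis
    proof (cases "set ws \<subseteq> dom V")
      case True
      have "\<forall>q\<in>set ws. \<exists>t0. \<forall>t\<ge>t0. F [t, string_encode q] \<noteq> 0"
      proof
        fix q assume "q \<in> set ws"
        then obtain v where "V q = Some v" using True by blast
        from complete[rule_format, OF this] obtain t0
          where "\<forall>t\<ge>t0. F [t, string_encode q] = Suc (string_encode v)" by (rule exE)
        then show "\<exists>t0. \<forall>t\<ge>t0. F [t, string_encode q] \<noteq> 0" by (intro exI[of _ t0]) simp
      qed
      from uniform_eventually[OF finite_set this] obtain s0
        where "\<forall>t\<ge>s0. \<forall>q\<in>set ws. F [t, string_encode q] \<noteq> 0" by (rule exE)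
      then have ex: "\<exists>s. running (s # ?xs) = 0"
        unfolding running by (intro exI[of _ s0]) simp
      define s where "s = (LEAST s. running (s # ?xs) = 0)"
      have s: "?time ?xs = Some s" "running (s # ?xs) = 0"
        using ex LeastI_ex[OF ex] by (auto simp: minimise_total s_def)
      \<comment> \<open>With fuel \<open>s\<close> every listed program has finished, so removing
        the successor gives the number of its output.\<close>
      have "F [s, string_encode q] - 1 = string_encode (the (V q))" if "q \<in> set ws" for q
        using s(2) halts[of s q] that unfolding running by simp
      then have "hit (s # ?xs) = of_bool
          (\<exists>q\<in>set ws. H [string_encode (the (V q)), string_encode w] \<noteq> 0)"
        unfolding hit by simp
      then show ?thesis using True s(1) by (simp add: compose_def)
    next
      case False
      \<comment> \<open>A single program that does not halt keeps the flag at 1 for every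
        fuel.\<close>
      then have "\<nexists>s. running (s # ?xs) = 0" unfolding running using halts by blast
      then have "?time ?xs = None" by (simp add: minimise_total)
      then show ?thesis using False by (simp add: compose_def)
    qed
  qed
  moreover obtain g where "partial_recursive 2 g" "\<And>xs. length xs = 2 \<Longrightarrow> g xs = ?f xs"
    using f unfolding recursive_on_def by blast
  ultimately show ?thesis
    unfolding computable_test_def by (intro exI[of _ g]) auto
qed

theorem theorem3p6:
  fixes V :: "bool list \<Rightarrow> bool list option"
  assumes "optimal V"
  shows "\<forall>C. computer C \<longrightarrow>
           (\<exists>d::nat. \<exists>A. computable_test A \<and>
             (\<forall>p qs. set qs = {q \<in> dom V. length q \<le> length p + d} \<longrightarrow>
               A p qs = Some (p \<in> dom C)))"
proof (intro allI impI)
  fix C assume "computer C"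
  from halting_time_computer[OF this] obtain H D where H: "total_recursive 2 H" and D: "computer D" "dom D = dom C"
    and sound: "\<And>p t. H [t, string_encode p] \<noteq> 0 \<Longrightarrow> p \<in> dom C"
    and time: "\<And>p s. D p = Some s \<Longrightarrow> H [string_encode s, string_encode p] \<noteq> 0"
    by blast
  have "computable V" using assms by (simp add: optimal_def computer_def)
  \<comment> \<open>Optimality is applied to the halting-time computer \<open>D\<close>, not to
    \<open>C\<close> itself.\<close>
  obtain d where d: "\<forall>p\<in>dom D. \<exists>q. V q = D p \<and> length q \<le> length p + d"
    using assms D(1) unfolding optimal_def by blast
  let ?A = "\<lambda>w ws. if set ws \<subseteq> dom V
    then Some (\<exists>q\<in>set ws. H [string_encode (the (V q)), string_encode w] \<noteq> 0) else None"
  have correct: "?A p qs = Some (p \<in> dom C)" if qs: "set qs = {q \<in> dom V. length q \<le> length p + d}" for p qs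
  proof -
    \<comment> \<open>The witness is a program of \<open>V\<close> for the output
      \<open>D p\<close>; the bound on its length puts it in the list. The converse, where a listed
      output may have nothing to do with \<open>p\<close>, is \<open>sound\<close>.\<close>
    have "\<exists>q\<in>set qs. H [string_encode (the (V q)), string_encode p] \<noteq> 0" if p: "p \<in> dom C"
    proof -
      obtain q where q: "V q = D p" "length q \<le> length p + d" using d p D(2) by blast
      moreover obtain s where "D p = Some s" using p D(2) by blast
      ultimately show ?thesis using time qs by (intro bexI[of _ q]) auto
    qed
    with sound qs show ?thesis by auto
  qed
  show "\<exists>d A. computable_test A \<and> (\<forall>p qs. set qs = {q \<in> dom V. length q \<le> length p + d} \<longrightarrow>
      A p qs = Some (p \<in> dom C))"
  proof (intro exI conjI allI impI)
    show "computable_test ?A" by (rule computable_test_halting[OF \<open>computable V\<close> H])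
  qed (rule correct)
qed

end
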